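(* For every odd integer $n\ge 5$, $$CAN(QI(n,2),2) < CAN(K_{\chi(QI(n,2))},2).$$
   Context: For $n\ge 4$, $QI(n,2)$ is the graph whose vertices are all partitions $\{A_1,A_2\}$ of $\{1,\dots,n\}$ into two classes, each of size at least $2$; two vertices $\{A_1,A_2\}$ and $\{B_1,B_2\}$ are adjacent if and only if $A_i\cap B_j\neq\emptyset$ for all $i,j\in\{1,2\}$. $\chi$ denotes the chromatic number and $K_m$ the complete graph on $m$ vertices. Two vectors $u,v\in\{0,1\}^m$ are qualitatively independent if for every ordered pair $(a,b)\in\{0,1\}^2$ there is an index $i$ with $(u_i,v_i)=(a,b)$. For a finite simple graph $G$, a covering array $CA(m,G,2)$ is a $|V(G)|\times m$ array with entries from $\{0,1\}$ whose rows correspond to the vertices of $G$, such that any two rows corresponding to adjacent vertices are qualitatively independent. $CAN(G,2)$ is the smallest positive integer $m$ such that a $CA(m,G,2)$ exists. *)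

theory Defs
  imports "Graph_Theory.Graph_Theory" "HOL-Library.Disjoint_Sets"
begin

text \<open>
  Finite simple graphs are the symmetric loop-free digraphs of \<^locale>\<open>pair_graph\<close>:
  every undirected edge \<open>uv\<close> is represented by the two arcs \<open>(u, v)\<close> and \<open>(v, u)\<close>.
\<close>

subsection \<open>Chromatic number and complete graphs\<close>

definition proper_coloring :: "nat \<Rightarrow> 'a pair_pre_digraph \<Rightarrow> ('a \<Rightarrow> nat) \<Rightarrow> bool" where
  "proper_coloring k G f \<longleftrightarrow>
     (\<forall>v \<in> pverts G. f v < k) \<and> (\<forall>(u, v) \<in> parcs G. f u \<noteq> f v)"

definition chromatic_number :: "'a pair_pre_digraph \<Rightarrow> nat" where
  "chromatic_number G = (LEAST k. \<exists>f. proper_coloring k G f)"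

definition complete_graph :: "nat \<Rightarrow> nat pair_pre_digraph" where
  "complete_graph m = \<lparr> pverts = {..<m}, parcs = {(i, j). i < m \<and> j < m \<and> i \<noteq> j} \<rparr>"

lemma complete_digraph_complete_graph: "complete_digraph m (with_proj (complete_graph m))"
  by (auto simp: complete_digraph_pair_def complete_graph_def)

lemma pair_graph_complete_graph: "pair_graph (complete_graph m)"
  by (rule pair_graphI_complete[OF complete_digraph_complete_graph])

subsection \<open>Covering arrays on graphs\<close>

text \<open>
  A vector of length \<open>m\<close> is a function on \<open>nat\<close> of which only the values at
  the indices \<open>i < m\<close> matter; an array maps each vertex to its row.
\<close>

definition qualitatively_independent :: "nat \<Rightarrow> (nat \<Rightarrow> nat) \<Rightarrow> (nat \<Rightarrow> nat) \<Rightarrow> bool" where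
  "qualitatively_independent m u v \<longleftrightarrow>
     (\<forall>a \<in> {0, 1}. \<forall>b \<in> {0, 1}. \<exists>i < m. u i = a \<and> v i = b)"

definition covering_array ::
    "nat \<Rightarrow> 'a pair_pre_digraph \<Rightarrow> ('a \<Rightarrow> nat \<Rightarrow> nat) \<Rightarrow> bool" where
  "covering_array m G C \<longleftrightarrow>
     (\<forall>v \<in> pverts G. \<forall>i < m. C v i \<in> {0, 1}) \<and>
     (\<forall>(u, v) \<in> parcs G. qualitatively_independent m (C u) (C v))"

definition CAN :: "'a pair_pre_digraph \<Rightarrow> nat" where
  "CAN G = (LEAST m. 0 < m \<and> (\<exists>C. covering_array m G C))"

subsection \<open>The graph of partitions into two classes of size at least two\<close>

definition QI_vertices :: "nat \<Rightarrow> nat set set set" where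
  "QI_vertices n = {P. partition_on {1..n} P \<and> card P = 2 \<and> (\<forall>A \<in> P. 2 \<le> card A)}"

definition QI :: "nat \<Rightarrow> nat set set pair_pre_digraph" where
  "QI n = \<lparr> pverts = QI_vertices n,
            parcs = {(P, Q). P \<in> QI_vertices n \<and> Q \<in> QI_vertices n \<and>
                             (\<forall>A \<in> P. \<forall>B \<in> Q. A \<inter> B \<noteq> {})} \<rparr>"

lemma finite_QI_vertices: "finite (QI_vertices n)"
  by (rule finite_subset[of _ "Pow (Pow {1..n})"])
    (auto simp: QI_vertices_def partition_on_def)

lemma QI_adjacent_neq:
  assumes "(P, Q) \<in> parcs (QI n)"
  shows "P \<noteq> Q"
proof
  assume "P = Q"
  with assms have part: "partition_on {1..n} P" and "card P = 2"
    and meet: "\<forall>A \<in> P. \<forall>B \<in> P. A \<inter> B \<noteq> {}"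
    by (auto simp: QI_def QI_vertices_def)
  from \<open>card P = 2\<close> obtain A B where "A \<in> P" "B \<in> P" "A \<noteq> B"
    by (auto simp: card_2_iff)
  with part meet show False
    by (auto simp: partition_on_def disjoint_def)
qed

lemma pair_graph_QI: "pair_graph (QI n)"
proof
  show "finite (pverts (QI n))"
    by (simp add: QI_def finite_QI_vertices)
  show "finite (parcs (QI n))"
    by (rule finite_subset[of _ "QI_vertices n \<times> QI_vertices n"])
      (auto simp: QI_def finite_QI_vertices)
  show "symmetric (with_proj (QI n))"
    by (auto simp: symmetric_def QI_def intro!: symI)
  show "fst e \<noteq> snd e" if "e \<in> parcs (QI n)" for e
    using QI_adjacent_neq[of "fst e" "snd e" n] that by simp
qed (auto simp: QI_def)

subsection \<open>The minima defining the chromatic number and CAN are attained\<close>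

lemma (in pair_graph) chromatic_number_attained: "\<exists>f. proper_coloring (chromatic_number G) G f"
proof -
  obtain f where f: "bij_betw f (pverts G) {..<card (pverts G)}"
    using ex_bij_betw_finite_nat[OF pair_finite_verts] by (auto simp: atLeast0LessThan)
  have "f v < card (pverts G)" if "v \<in> pverts G" for v
    using bij_betwE[OF f] that by blast
  moreover have "f u \<noteq> f v" if "(u, v) \<in> parcs G" for u v
    using inj_onD[OF bij_betw_imp_inj_on[OF f], of u v] in_arcsD1[OF that] in_arcsD2[OF that]
      pair_no_loops[OF that] by auto
  ultimately have "proper_coloring (card (pverts G)) G f"
    unfolding proper_coloring_def by blast
  then have "\<exists>k f. proper_coloring k G f" by blast
  then show ?thesis unfolding chromatic_number_def by (rule LeastI_ex)
qed

lemma (in pair_graph) CAN_attained: "0 < CAN G \<and> (\<exists>C. covering_array (CAN G) G C)"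
proof -
  obtain f :: "'a \<Rightarrow> nat" where f: "inj_on f (pverts G)"
    using finite_imp_inj_to_nat_seg[OF pair_finite_verts] by blast
  define N where "N = Suc (Max (insert 0 (f ` pverts G)))"
  define C :: "'a \<Rightarrow> nat \<Rightarrow> nat" where "C v c = of_bool (bit c (f v))" for v c
  have less: "f v < N" if "v \<in> pverts G" for v
    using that pair_finite_verts by (auto simp: N_def less_Suc_eq_le)
  have "qualitatively_independent (2 ^ N) (C u) (C v)" if uv: "(u, v) \<in> parcs G" for u v
    unfolding qualitatively_independent_def
  proof (intro ballI)
    fix a b :: nat
    assume ab: "a \<in> {0, 1}" "b \<in> {0, 1}"
    have verts: "u \<in> pverts G" "v \<in> pverts G" and "u \<noteq> v"
      using uv pair_no_loops[of "(u, v)"] in_arcsD1 in_arcsD2 by auto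
    then have neq: "f u \<noteq> f v" using f by (auto dest: inj_onD)
    define c :: nat where "c = take_bit N (or (a * 2 ^ f u) (b * 2 ^ f v))"
    have "c < 2 ^ N" unfolding c_def by (rule take_bit_nat_less_exp)
    moreover have "C u c = a" "C v c = b"
      using ab neq less[OF verts(1)] less[OF verts(2)]
      by (auto simp: C_def c_def bit_take_bit_iff bit_or_iff bit_exp_iff)
    ultimately show "\<exists>i < 2 ^ N. C u i = a \<and> C v i = b" by blast
  qed
  then have "covering_array (2 ^ N) G C"
    by (auto simp: covering_array_def C_def)
  then have "\<exists>m > 0. \<exists>C. covering_array m G C"
    by (intro exI[of _ "2 ^ N"]) auto
  then show ?thesis unfolding CAN_def by (rule LeastI_ex)
qed

end

theory Submission
  imports Defs
begin

text \<open>
  Write \<open>n = 2 * k + 1\<close> with \<open>k \<ge> 2\<close>. Both sides are compared with \<open>n\<close>.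

  On the one hand \<open>CAN (QI n) \<le> n\<close>: the indicator vector of either class of a partition can
  serve as its row, since adjacency in \<open>QI n\<close> says exactly that the indicator vectors are
  qualitatively independent (\<open>CAN_QI_le\<close>).

  On the other hand, let \<open>r\<close> be the chromatic number of \<open>QI n\<close>. The partitions into classes of
  sizes \<open>k\<close> and \<open>k + 1\<close> correspond to the \<open>k\<close>-subsets of \<open>{1..n}\<close>, and two of them are
  non-adjacent only if the \<open>k\<close>-subsets are disjoint. There is no room for three pairwise disjoint
  ones, so every colour is used at most twice on them, and \<open>2 * r \<ge> n choose k\<close>
  (\<open>two_chromatic_number_QI_ge\<close>).

  A covering array of \<open>K\<^sub>r\<close> with at most \<open>n\<close> columns would contradict this. Complementing rows
  if necessary, its rows become an intersecting antichain of \<open>r\<close> sets of size at most \<open>k\<close> in an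
  \<open>n\<close>-set. Pushing the small members upwards by upper shadows turns the antichain into an
  intersecting family \<open>G\<close> of at least \<open>r\<close> sets of size exactly \<open>k\<close>. Its upper shadow has at
  least \<open>card G\<close> members and contains no complement of a member of \<open>G\<close>, since two members
  of \<open>G\<close> always meet; so the \<open>k + 1\<close>-subsets number at least \<open>2 * card G\<close>. Equality would make
  \<open>G\<close> closed under exchanging one element for another, and then \<open>G\<close> would contain two disjoint
  sets. Hence \<open>2 * r < n choose k\<close> (\<open>two_card_intersecting_antichain_less\<close>).
\<close>

section \<open>Upper shadows\<close>

definition upper_shadow :: "'a set \<Rightarrow> 'a set set \<Rightarrow> 'a set set" where
  "upper_shadow X G = {insert x A |x A. A \<in> G \<and> x \<in> X - A}"

lemma upper_shadow_subset:
  assumes "finite X" "G \<subseteq> {A. A \<subseteq> X \<and> card A = s}"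
  shows "upper_shadow X G \<subseteq> {B. B \<subseteq> X \<and> card B = Suc s}"
proof -
  have "finite A" if "A \<in> G" for A
    using that assms by (auto dest: finite_subset)
  then show ?thesis
    using assms(2) by (auto simp: upper_shadow_def card_insert_if)
qed

lemma finite_family_of_subsets:
  assumes "finite X" "G \<subseteq> {A. A \<subseteq> X \<and> P A}"
  shows "finite G"
  using assms by (auto intro: finite_subset[of G "Pow X"])

text \<open>
  Both facts below come from counting the pairs \<open>A \<subset> insert x A\<close> twice. Such a pair is
  recorded on the left by \<open>(A, x)\<close> and on the right by \<open>(insert x A, x)\<close>; the right-hand pairs
  that are missed are the \<open>(B, y)\<close> for which \<open>B - {y}\<close> lies outside \<open>G\<close>.
\<close>

lemma
  assumes "finite X" "G \<subseteq> {A. A \<subseteq> X \<and> card A = s}"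
  shows card_upper_shadow_ge: "card G * (card X - s) \<le> card (upper_shadow X G) * Suc s" (is ?ge)
    and upper_shadow_tight_remove:
      "\<lbrakk>card (upper_shadow X G) * Suc s \<le> card G * (card X - s); B \<in> upper_shadow X G; y \<in> B\<rbrakk>
        \<Longrightarrow> B - {y} \<in> G"
proof -
  define I where "I = (SIGMA A:G. X - A)"
  define J where "J = (SIGMA B:upper_shadow X G. B)"
  define h where "h = (\<lambda>(A, x :: 'a). (insert x A, x))"
  have shadow: "upper_shadow X G \<subseteq> {B. B \<subseteq> X \<and> card B = Suc s}"
    by (rule upper_shadow_subset[OF assms])
  have fin: "finite G" "finite (upper_shadow X G)"
    by (rule finite_family_of_subsets[OF assms] finite_family_of_subsets[OF assms(1) shadow])+
  have finJ: "finite J"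
    unfolding J_def using fin shadow assms(1) by (auto intro: finite_subset)
  have cardI: "card I = card G * (card X - s)"
  proof -
    have "card (X - A) = card X - s" if "A \<in> G" for A
      using that assms by (subst card_Diff_subset) (auto dest: finite_subset)
    then show ?thesis
      using fin assms(1) by (simp add: I_def)
  qed
  have cardJ: "card J = card (upper_shadow X G) * Suc s"
  proof -
    have "card B = Suc s" if "B \<in> upper_shadow X G" for B
      using that shadow by auto
    moreover have "finite B" if "B \<in> upper_shadow X G" for B
      using that shadow assms(1) by (auto dest: finite_subset)
    ultimately show ?thesis
      using fin by (simp add: J_def)
  qed
  have inj: "inj_on h I"
    by (rule inj_on_inverseI[where g = "\<lambda>(B, x). (B - {x}, x)"]) (auto simp: h_def I_def)
  have sub: "h ` I \<subseteq> J"
    by (auto simp: h_def I_def J_def upper_shadow_def)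
  have card_h: "card (h ` I) = card I"
    by (rule card_image[OF inj])
  show ?ge
    using card_mono[OF finJ sub] unfolding card_h cardI cardJ .
  assume le: "card (upper_shadow X G) * Suc s \<le> card G * (card X - s)"
    and By: "B \<in> upper_shadow X G" "y \<in> B"
  have "h ` I = J"
    using card_seteq[OF finJ sub] le unfolding card_h cardI cardJ by blast
  moreover have "(B, y) \<in> J"
    using By by (simp add: J_def)
  ultimately show "B - {y} \<in> G"
    by (auto simp: h_def I_def)
qed

lemma card_le_card_upper_shadow:
  assumes "finite X" "G \<subseteq> {A. A \<subseteq> X \<and> card A = s}" "2 * s < card X"
  shows "card G \<le> card (upper_shadow X G)"
proof -
  have "card G * Suc s \<le> card G * (card X - s)"
    using assms(3) by (intro mult_le_mono2) simp
  also have "\<dots> \<le> card (upper_shadow X G) * Suc s"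
    by (rule card_upper_shadow_ge[OF assms(1,2)])
  finally show ?thesis by (simp only: mult_le_cancel2)
qed

section \<open>Intersecting antichains\<close>

definition intersecting :: "'a set set \<Rightarrow> bool" where
  "intersecting F \<longleftrightarrow> (\<forall>A \<in> F. \<forall>B \<in> F. A \<inter> B \<noteq> {})"

definition antichain :: "'a set set \<Rightarrow> bool" where
  "antichain F \<longleftrightarrow> (\<forall>A \<in> F. \<forall>B \<in> F. A \<subseteq> B \<longrightarrow> A = B)"

text \<open>
  The members of the smallest size \<open>s\<close> can be replaced by their upper shadow as long as
  \<open>s < k\<close>: below the middle level this does not decrease the number of sets, and
  enlarging sets keeps them intersecting. That the family is an antichain ensures that the new
  sets are not already present; the property survives because no set of size above \<open>s\<close> contained
  a member of size \<open>s\<close>.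
\<close>

lemma intersecting_antichain_lift_to_level:
  assumes "finite X" "2 * k \<le> card X" "s \<le> k"
    and "F \<subseteq> {A. A \<subseteq> X \<and> s \<le> card A \<and> card A \<le> k}" "intersecting F" "antichain F"
  shows "\<exists>G. G \<subseteq> {A. A \<subseteq> X \<and> card A = k} \<and> intersecting G \<and> card F \<le> card G"
  using assms(3-)
proof (induction s arbitrary: F rule: inc_induct)
  case base
  then have "F \<subseteq> {A. A \<subseteq> X \<and> card A = k}" by auto
  with base show ?case by blast
next
  case (step s)
  define L where "L = {A \<in> F. card A = s}"
  define U where "U = upper_shadow X L"
  define F' where "F' = (F - L) \<union> U"
  have L: "L \<subseteq> {A. A \<subseteq> X \<and> card A = s}"
    using step.prems by (auto simp: L_def)
  have U: "U \<subseteq> {B. B \<subseteq> X \<and> card B = Suc s}"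
    unfolding U_def by (rule upper_shadow_subset[OF assms(1) L])
  have high: "Suc s \<le> card C" if "C \<in> F - L" for C
    using that step.prems(1) by (force simp: L_def)
  have above: "\<exists>A \<in> F. A \<subseteq> C" if "C \<in> F'" for C
    using that by (auto simp: F'_def U_def upper_shadow_def L_def)
  have below: "\<exists>A \<in> L. A \<subset> B" if "B \<in> U" for B
    using that by (auto simp: U_def upper_shadow_def)
  have finX: "finite B" if "B \<subseteq> X" for B
    using that assms(1) by (rule finite_subset)
  have F'_size: "F' \<subseteq> {A. A \<subseteq> X \<and> Suc s \<le> card A \<and> card A \<le> k}"
    using step.prems(1) step.hyps high U by (auto simp: F'_def)
  have noU: "\<not> B \<subseteq> C" if "B \<in> U" "C \<in> F - L" for B C
    using below[OF that(1)] that(2) step.prems(3) unfolding antichain_def L_def by blast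
  have eq_if_sub: "C = B" if "C \<subseteq> B" "B \<in> U" "C \<in> F'" for B C
  proof (rule card_seteq)
    show "finite B" using U that finX by blast
    show "card B \<le> card C" using subsetD[OF U that(2)] subsetD[OF F'_size that(3)] by simp
  qed (fact that(1))
  have "antichain F'"
    unfolding antichain_def
  proof (intro ballI impI)
    fix C B assume CB: "C \<in> F'" "B \<in> F'" "C \<subseteq> B"
    show "C = B"
    proof (cases "B \<in> U")
      case True
      then show ?thesis using eq_if_sub CB by blast
    next
      case False
      then have "B \<in> F - L" using CB by (simp add: F'_def)
      moreover from this have "C \<notin> U" using noU CB by blast
      ultimately have "B \<in> F" "C \<in> F" using CB by (auto simp: F'_def)
      then show ?thesis using CB step.prems(3) by (simp add: antichain_def)
    qed
  qed
  moreover have "intersecting F'"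
    unfolding intersecting_def
  proof (intro ballI)
    fix B C assume "B \<in> F'" "C \<in> F'"
    then obtain A A' where "A \<in> F" "A \<subseteq> B" "A' \<in> F" "A' \<subseteq> C" using above by metis
    moreover from this have "A \<inter> A' \<noteq> {}"
      using step.prems(2) by (simp add: intersecting_def)
    ultimately show "B \<inter> C \<noteq> {}" by blast
  qed
  moreover have "card F \<le> card F'"
  proof -
    have finF: "finite F"
      using assms(1) step.prems(1) by (rule finite_family_of_subsets)
    have finU: "finite U"
      using assms(1) U by (rule finite_family_of_subsets)
    have "card F = card (F - L) + card L"
      using finF by (subst card_Un_disjoint[symmetric]) (auto simp: L_def intro: arg_cong[of _ _ card])
    also have "card L \<le> card U"
      unfolding U_def using assms(2) step.hyps
      by (intro card_le_card_upper_shadow[OF assms(1) L]) simp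
    also have "card (F - L) + card U = card F'"
      unfolding F'_def using finF finU noU by (subst card_Un_disjoint) auto
    finally show ?thesis by simp
  qed
  ultimately show ?case
    using step.IH[OF F'_size] by (meson le_trans)
qed

text \<open>
  A family of sets of one size that is closed under exchanging an element for an outside element
  contains disjoint sets, provided that there is room: exchanging common elements with a fixed
  member moves away from it step by step.
\<close>

lemma exchange_closed_not_intersecting:
  assumes "finite X" "2 * k \<le> card X" "G \<subseteq> {A. A \<subseteq> X \<and> card A = k}" "G \<noteq> {}"
    and exchange: "\<And>A x y. \<lbrakk>A \<in> G; x \<in> A; y \<in> X - A\<rbrakk> \<Longrightarrow> insert y A - {x} \<in> G"
  shows "\<not> intersecting G"
proof
  assume int: "intersecting G"
  obtain A0 where A0: "A0 \<in> G" using assms(4) by blast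
  define A where "A = arg_min_on (\<lambda>A. card (A \<inter> A0)) G"
  have finG: "finite G" using assms(1,3) by (rule finite_family_of_subsets)
  have A: "A \<in> G" and least: "card (A \<inter> A0) \<le> card (B \<inter> A0)" if "B \<in> G" for B
    unfolding A_def using finG assms(4) that
    by (auto intro: arg_min_if_finite(1) arg_min_least)
  have AG: "A \<in> G" using A[OF A0] .
  obtain x where x: "x \<in> A" "x \<in> A0"
    using int A0 AG unfolding intersecting_def by blast
  have fin: "finite A" "finite A0"
    using AG A0 assms(1,3) by (auto dest: finite_subset)
  have "card (A \<union> A0) + card (A \<inter> A0) = 2 * k"
    using card_Un_Int[OF fin] subsetD[OF assms(3) AG] subsetD[OF assms(3) A0] by simp
  moreover have "card (A \<inter> A0) > 0"
    using x fin by (auto simp: card_gt_0_iff)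
  ultimately have "card (A \<union> A0) < card X" using assms(2) by linarith
  then have "\<not> X \<subseteq> A \<union> A0"
    using fin card_mono[of "A \<union> A0" X] by auto
  then obtain y where y: "y \<in> X" "y \<notin> A" "y \<notin> A0" by blast
  have "insert y A - {x} \<in> G" using exchange AG x y by blast
  then have "card (A \<inter> A0) \<le> card ((insert y A - {x}) \<inter> A0)" by (rule least)
  moreover have "(insert y A - {x}) \<inter> A0 \<subset> A \<inter> A0" using x y by blast
  then have "card ((insert y A - {x}) \<inter> A0) < card (A \<inter> A0)"
    using fin by (intro psubset_card_mono) auto
  ultimately show False by simp
qed

text \<open>
  A member of the upper shadow that is the complement of a member \<open>B\<close> contains a member disjoint
  from \<open>B\<close>. So the upper shadow and the complements compete for the same \<open>k + 1\<close>-subsets. If they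
  used up all of them, the upper shadow would be no larger than \<open>G\<close>. The double count is then
  tight, so removing any element from a member of the upper shadow leads back into \<open>G\<close>, and \<open>G\<close>
  is closed under exchanges.
\<close>

lemma two_card_intersecting_level_less:
  assumes X: "finite X" "card X = 2 * k + 1" and G: "G \<subseteq> {A. A \<subseteq> X \<and> card A = k}"
    and int: "intersecting G"
  shows "2 * card G < (2 * k + 1) choose k"
proof (rule ccontr)
  assume "\<not> ?thesis"
  then have ge: "(2 * k + 1) choose k \<le> 2 * card G" by simp
  define U where "U = upper_shadow X G"
  define D where "D = (\<lambda>A. X - A) ` G"
  have U: "U \<subseteq> {B. B \<subseteq> X \<and> card B = Suc k}"
    unfolding U_def by (rule upper_shadow_subset[OF X(1) G])
  have "card (X - A) = Suc k" if "A \<in> G" for A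
    using that G X by (subst card_Diff_subset) (auto dest: finite_subset)
  then have D: "D \<subseteq> {B. B \<subseteq> X \<and> card B = Suc k}"
    by (auto simp: D_def)
  have "inj_on (\<lambda>A. X - A) G"
    using G by (intro inj_on_inverseI[where g = "\<lambda>A. X - A"]) auto
  then have cardD: "card D = card G"
    unfolding D_def by (rule card_image)
  have "\<exists>A \<in> G. A \<subseteq> B" if "B \<in> U" for B
    using that by (auto simp: U_def upper_shadow_def)
  then have "U \<inter> D = {}"
    using int unfolding D_def intersecting_def by blast
  then have "card U + card D = card (U \<union> D)"
    using X(1) U D by (simp add: card_Un_disjoint finite_family_of_subsets)
  also have "\<dots> \<le> card {B. B \<subseteq> X \<and> card B = Suc k}"
    using U D X(1) by (intro card_mono) auto
  also have "\<dots> = (2 * k + 1) choose Suc k"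
    using n_subsets[OF X(1), of "Suc k"] X(2) by simp
  also have "\<dots> = (2 * k + 1) choose k"
    using binomial_symmetric[of k "2 * k + 1"] by simp
  finally have tight: "card U \<le> card G" using cardD ge by simp
  have remove: "B - {x} \<in> G" if "B \<in> U" "x \<in> B" for B x
  proof (rule upper_shadow_tight_remove[OF X(1) G])
    show "card (upper_shadow X G) * Suc k \<le> card G * (card X - k)"
      using mult_le_mono1[OF tight, of "Suc k"] X(2) by (simp add: U_def)
  qed (use that in \<open>auto simp: U_def\<close>)
  have "\<not> intersecting G"
  proof (rule exchange_closed_not_intersecting[OF X(1) _ G])
    show "G \<noteq> {}"
      using ge by (auto simp: binomial_eq_0_iff)
    show "insert y A - {x} \<in> G" if "A \<in> G" "x \<in> A" "y \<in> X - A" for A x y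
      using that by (intro remove) (auto simp: U_def upper_shadow_def)
  qed (use X(2) in simp)
  then show False using int by contradiction
qed

lemma two_card_intersecting_antichain_less:
  assumes "finite X" "card X = 2 * k + 1" "F \<subseteq> {A. A \<subseteq> X \<and> card A \<le> k}"
    and "intersecting F" "antichain F"
  shows "2 * card F < (2 * k + 1) choose k"
proof -
  obtain G where "G \<subseteq> {A. A \<subseteq> X \<and> card A = k}" "intersecting G" "card F \<le> card G"
    using intersecting_antichain_lift_to_level[of X k 0 F] assms by auto
  then show ?thesis
    using two_card_intersecting_level_less[OF assms(1,2), of G] by linarith
qed

section \<open>Covering arrays of complete graphs\<close>

text \<open>
  Each row is read as the set of its ones or, if that set is larger than \<open>k\<close>, as its complement.
  Qualitative independence is invariant under complementing rows, so in either case no set is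
  contained in another and any two meet. Columns beyond \<open>m\<close> are harmless, as extra
  columns do not destroy qualitative independence.
\<close>

lemma covering_array_complete_graph_bound:
  assumes "covering_array m (complete_graph r) C" "m \<le> 2 * k + 1" "2 \<le> r"
  shows "2 * r < (2 * k + 1) choose k"
proof -
  define X where "X = {..<2 * k + 1}"
  define T where "T i = {j \<in> X. C i j = 1}" for i
  define S where "S i = (if card (T i) \<le> k then T i else X - T i)" for i
  have X: "finite X" "card X = 2 * k + 1" by (auto simp: X_def)
  have TX: "T i \<subseteq> X" for i by (auto simp: T_def)
  have quad: "T i \<inter> T j \<noteq> {} \<and> T i - T j \<noteq> {} \<and> T j - T i \<noteq> {} \<and> X - (T i \<union> T j) \<noteq> {}"
    if "i < r" "j < r" "i \<noteq> j" for i j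
  proof -
    have qi: "qualitatively_independent m (C i) (C j)"
      using assms(1) that by (auto simp: covering_array_def complete_graph_def)
    have "\<exists>c \<in> X. C i c = a \<and> C j c = b" if "a \<in> {0, 1}" "b \<in> {0, 1}" for a b
      using qi that assms(2) unfolding qualitatively_independent_def X_def
      by (meson lessThan_iff less_le_trans)
    from this[of 1 1] this[of 1 0] this[of 0 1] this[of 0 0] show ?thesis
      by (fastforce simp: T_def)
  qed
  have cross: "S i \<inter> S j \<noteq> {} \<and> \<not> S i \<subseteq> S j" if "i < r" "j < r" "i \<noteq> j" for i j
    using quad[OF that] TX[of i] TX[of j] unfolding S_def by (auto split: if_splits)
  have "inj_on S {..<r}"
    using cross by (intro inj_onI) (metis lessThan_iff subset_refl)
  then have "card (S ` {..<r}) = r" by (simp add: card_image)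
  moreover have "2 * card (S ` {..<r}) < (2 * k + 1) choose k"
  proof (rule two_card_intersecting_antichain_less[OF X])
    have "card (X - T i) = 2 * k + 1 - card (T i)" for i
      using TX X by (metis card_Diff_subset finite_subset)
    then show "S ` {..<r} \<subseteq> {A. A \<subseteq> X \<and> card A \<le> k}"
      using TX by (auto simp: S_def)
    have "S i \<inter> S j \<noteq> {}" if "i < r" "j < r" for i j
    proof (cases "i = j")
      case True
      (* a set is nonempty because it meets the set of some other row *)
      have "\<exists>l < r. l \<noteq> i"
        using assms(3) by (intro exI[of _ "if i = 0 then 1 else 0"]) auto
      with True cross that show ?thesis by blast
    qed (use cross that in blast)
    then show "intersecting (S ` {..<r})" by (auto simp: intersecting_def)
    show "antichain (S ` {..<r})" using cross by (fastforce simp: antichain_def)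
  qed
  ultimately show ?thesis by simp
qed

section \<open>The graph of partitions\<close>

lemma CAN_QI_le:
  assumes "0 < n"
  shows "CAN (QI n) \<le> n"
proof -
  define cls :: "nat set set \<Rightarrow> nat set" where "cls P = (SOME A. A \<in> P)" for P
  (* the columns are numbered from 0, the points of the partitions from 1 *)
  define C :: "nat set set \<Rightarrow> nat \<Rightarrow> nat" where "C P i = of_bool (Suc i \<in> cls P)" for P i
  have split: "\<exists>B. P = {cls P, B} \<and> cls P \<union> B = {1..n} \<and> cls P \<inter> B = {}"
    if P: "P \<in> QI_vertices n" for P
  proof -
    from P have "card P = 2" and part: "partition_on {1..n} P" by (auto simp: QI_vertices_def)
    then have "P \<noteq> {}" by auto
    then have "cls P \<in> P" unfolding cls_def by (simp add: some_in_eq)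
    with \<open>card P = 2\<close> obtain B where "P = {cls P, B}" "cls P \<noteq> B"
      by (auto simp: card_2_iff)
    with part show ?thesis
      by (metis Union_insert Union_empty Un_empty_right disjointD insertCI partition_onD1 partition_onD2)
  qed
  have "qualitatively_independent n (C P) (C Q)" if PQ: "(P, Q) \<in> parcs (QI n)" for P Q
    unfolding qualitatively_independent_def
  proof (intro ballI)
    fix a b :: nat assume ab: "a \<in> {0, 1}" "b \<in> {0, 1}"
    from PQ have v: "P \<in> QI_vertices n" "Q \<in> QI_vertices n"
      and meet: "\<And>A B. A \<in> P \<Longrightarrow> B \<in> Q \<Longrightarrow> A \<inter> B \<noteq> {}"
      by (auto simp: QI_def)
    obtain A' where A': "P = {cls P, A'}" "cls P \<union> A' = {1..n}" "cls P \<inter> A' = {}"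
      using split[OF v(1)] by blast
    obtain B' where B': "Q = {cls Q, B'}" "cls Q \<union> B' = {1..n}" "cls Q \<inter> B' = {}"
      using split[OF v(2)] by blast
    have "(if a = 1 then cls P else A') \<inter> (if b = 1 then cls Q else B') \<noteq> {}"
      using A'(1) B'(1) by (intro meet) (metis insertCI)+
    then obtain x where x: "x \<in> (if a = 1 then cls P else A')" "x \<in> (if b = 1 then cls Q else B')"
      by blast
    with A' have "x \<in> {1..n}" by (metis UnCI)
    then have "x - 1 < n" "Suc (x - 1) = x" by auto
    moreover have "(x \<in> cls P) = (a = 1)" "(x \<in> cls Q) = (b = 1)"
      using x A'(3) B'(3) by (auto split: if_splits)
    ultimately show "\<exists>i < n. C P i = a \<and> C Q i = b"
      using ab by (intro exI[of _ "x - 1"]) (auto simp: C_def)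
  qed
  then have "covering_array n (QI n) C"
    by (auto simp: covering_array_def C_def)
  then show ?thesis
    unfolding CAN_def using assms by (intro Least_le) blast
qed

lemma half_in_QI_vertices:
  assumes "n = 2 * k + 1" "2 \<le> k" "A \<subseteq> {1..n}" "card A = k"
  shows "{A, {1..n} - A} \<in> QI_vertices n"
proof -
  have "finite A" using assms(3) by (rule finite_subset) simp
  then have c: "card ({1..n} - A) = Suc k"
    using assms by (subst card_Diff_subset) auto
  have "A \<noteq> {1..n} - A" using c assms(4) by (metis n_not_Suc_n)
  moreover have "A \<noteq> {}" "{1..n} - A \<noteq> {}" using c assms(2,4) by (metis card.empty not_numeral_le_zero, metis card.empty nat.distinct(1))
  ultimately have ne: "A \<noteq> {1..n} - A" "A \<noteq> {}" "{1..n} - A \<noteq> {}" by auto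
  then have "partition_on {1..n} {A, {1..n} - A}"
    using assms(3) by (auto simp: partition_on_def disjoint_def)
  then show ?thesis
    using c ne assms(2,4) by (simp add: QI_vertices_def)
qed

text \<open>
  If two different \<open>k\<close>-subsets of a \<open>2 * k + 1\<close>-set meet, then neither contains the other and
  their union misses a point, so the two partitions they define are adjacent.
\<close>

lemma QI_adjacent_if_halves_meet:
  assumes n: "n = 2 * k + 1" and k: "2 \<le> k"
    and A: "A \<subseteq> {1..n}" "card A = k" and B: "B \<subseteq> {1..n}" "card B = k"
    and "A \<noteq> B" "A \<inter> B \<noteq> {}"
  shows "({A, {1..n} - A}, {B, {1..n} - B}) \<in> parcs (QI n)"
proof -
  have fin: "finite A" "finite B" using A B by (auto dest: finite_subset)
  have "\<not> A \<subseteq> B" "\<not> B \<subseteq> A"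
    using card_subset_eq[OF fin(2), of A] card_subset_eq[OF fin(1), of B] assms by auto
  moreover have "\<not> {1..n} \<subseteq> A \<union> B"
    using card_mono[of "A \<union> B" "{1..n}"] card_Un_le[of A B] fin A B n by auto
  ultimately have "\<forall>V \<in> {A, {1..n} - A}. \<forall>W \<in> {B, {1..n} - B}. V \<inter> W \<noteq> {}"
    using A(1) B(1) \<open>A \<inter> B \<noteq> {}\<close> by auto
  then show ?thesis
    using half_in_QI_vertices[OF n k A] half_in_QI_vertices[OF n k B] by (simp add: QI_def)
qed

text \<open>
  The \<open>k\<close>-subsets of one colour are pairwise disjoint, and three of them would need \<open>3 * k\<close>
  points, more than the \<open>2 * k + 1\<close> available.
\<close>

lemma two_chromatic_number_QI_ge:
  assumes n: "n = 2 * k + 1" and k: "2 \<le> k"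
  shows "n choose k \<le> 2 * chromatic_number (QI n)"
proof -
  define r where "r = chromatic_number (QI n)"
  obtain f where f: "proper_coloring r (QI n) f"
    using pair_graph.chromatic_number_attained[OF pair_graph_QI] unfolding r_def by blast
  define K where "K = {A. A \<subseteq> {1..n} \<and> card A = k}"
  define g where "g A = f {A, {1..n} - A}" for A
  have finK: "finite K" unfolding K_def by (rule finite_family_of_subsets[OF _ order_refl]) simp
  have disj: "A \<inter> B = {}" if "A \<in> K" "B \<in> K" "A \<noteq> B" "g A = g B" for A B
    using QI_adjacent_if_halves_meet[OF n k, of A B] that f
    unfolding K_def g_def proper_coloring_def by blast
  have fibre: "card {A \<in> K. g A = c} \<le> 2" for c
  proof -
    let ?F = "{A \<in> K. g A = c}"
    have "card ?F * k = (\<Sum>A \<in> ?F. card A)" by (simp add: K_def)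
    also have "\<dots> = card (\<Union>?F)"
      using disj by (intro card_Union_disjoint[symmetric])
        (auto simp: pairwise_def disjnt_def K_def intro: finite_subset)
    also have "\<dots> \<le> card {1..n}"
      by (intro card_mono) (auto simp: K_def)
    also have "\<dots> < 3 * k" using n k by simp
    finally have "card ?F * k < 3 * k" .
    then have "card ?F < 3" by (simp only: mult_less_cancel2)
    then show ?thesis by simp
  qed
  have colour: "g A < r" if "A \<in> K" for A
    using half_in_QI_vertices[OF n k, of A] that f
    by (auto simp: K_def g_def proper_coloring_def QI_def)
  have "n choose k = card K"
    unfolding K_def using n_subsets[of "{1..n}" k] by simp
  also have "K = (\<Union>c<r. {A \<in> K. g A = c})" using colour by auto
  also have "card \<dots> \<le> (\<Sum>c<r. card {A \<in> K. g A = c})" by (rule card_UN_le) simp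
  also have "\<dots> \<le> of_nat (card {..<r}) * 2" by (rule sum_bounded_above) (rule fibre)
  finally show ?thesis by (simp add: r_def)
qed

theorem corollary5p3p5:
  fixes n :: nat
  assumes "odd n" and "5 \<le> n"
  shows "CAN (QI n) < CAN (complete_graph (chromatic_number (QI n)))"
proof -
  obtain k where n: "n = 2 * k + 1" using assms(1) by (rule oddE)
  with assms(2) have k: "2 \<le> k" by simp
  let ?r = "chromatic_number (QI n)"
  have ge: "n choose k \<le> 2 * ?r" by (rule two_chromatic_number_QI_ge[OF n k])
  have "n \<le> n choose k"
    using n k by (intro upper_le_binomial) auto
  with ge assms(2) have "2 \<le> ?r" by linarith
  obtain C where C: "covering_array (CAN (complete_graph ?r)) (complete_graph ?r) C"
    using pair_graph.CAN_attained[OF pair_graph_complete_graph] by blast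
  have "n < CAN (complete_graph ?r)"
  proof (rule ccontr)
    assume "\<not> ?thesis"
    then have "2 * ?r < n choose k"
      using covering_array_complete_graph_bound[OF C _ \<open>2 \<le> ?r\<close>] n by simp
    with ge show False by simp
  qed
  moreover have "CAN (QI n) \<le> n" using assms(2) by (intro CAN_QI_le) simp
  ultimately show ?thesis by simp
qed

end
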